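(* Let $G$ be a finite graph, let $\mathcal S$ be a separation system of $G$ that separates some set $\mathcal I$ of $\mathcal S$-inseparable sets of vertices well, and let $\mathcal N(\mathcal S,\mathcal I)$ be the nested subsystem of $\mathcal S$ constructed recursively from $\mathcal S$ and $\mathcal I$ as described in the context. Then for every automorphism $\alpha$ of $G$ we have $\mathcal N(\mathcal S^\alpha,\mathcal I^\alpha)=\mathcal N(\mathcal S,\mathcal I)^\alpha$. In particular, if $\mathcal S$ and $\mathcal I$ are invariant under the action of a group $\Gamma$ of automorphisms of $G$, then so is $\mathcal N(\mathcal S,\mathcal I)$.
   Context: A separation of $G=(V,E)$ is an ordered pair $(A,B)$ with $A,B\subseteq V$ and $G[A]\cup G[B]=G$; it is proper if $A\setminus B\neq\emptyset\neq B\setminus A$. Write $(A,B)\le(C,D)$ if $A\subseteq C$ and $B\supseteq D$. Two separations $(A,B),(C,D)$ are nested if $(A,B)$ is $\le$-comparable with $(C,D)$ or $(D,C)$; otherwise they cross. A separation system is a set of proper separations that contains $(B,A)$ whenever it contains $(A,B)$. $(A,B)$ separates a set $I\subseteq V$ if $I$ meets both $A\setminus B$ and $B\setminus A$. A set of vertices is $\mathcal S$-inseparable if no separation in $\mathcal S$ separates it. Two sets $I_0,I_1$ are weakly separated by $(A,B)$ if $I_i\subseteq A$ and $I_{1-i}\subseteq B$ for some $i\in\{0,1\}$; they are weakly $\mathcal S$-distinguishable if some element of $\mathcal S$ weakly separates them. A separation is $\mathcal I$-relevant if it weakly separates some two sets in $\mathcal I$. $\mathcal S$ separates $\mathcal I$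 well if for every pair of crossing separations $(A,B),(C,D)\in\mathcal S$ and all $I_1,I_2\in\mathcal I$ with $I_1\subseteq A\cap C$ and $I_2\subseteq B\cap D$ there is an $(E,F)\in\mathcal S$ such that $I_1\subseteq E\subseteq A\cap C$ and $F\supseteq B\cup D$. A separation $(E,F)$ in a separation system $\mathcal R$ is extremal in $\mathcal R$ if for all $(C,D)\in\mathcal R$ either $(E,F)\le(C,D)$ or $(E,F)\le(D,C)$. Construction of $\mathcal N(\mathcal S,\mathcal I)$ (recursively on $|\mathcal I|$): if no two elements of $\mathcal I$ are weakly $\mathcal S$-distinguishable, put $\mathcal N(\mathcal S,\mathcal I)=\emptyset$. Otherwise let $\mathcal R\subseteq\mathcal S$ be the set of all $\mathcal I$-relevant separations in $\mathcal S$, let $\mathcal E$ be the set of separations that are extremal in $\mathcal R$, let $\overline{\mathcal E}=\{(A,B)\mid (A,B)\in\mathcal E\text{ or }(B,A)\in\mathcal E\}$, let $\mathcal I_{\mathcal E}=\{I\in\mathcal I\mid \exists (E,F)\in\mathcal E: I\subseteq E\}$ (which is non-empty), let $\mathcal I'=\mathcal I\setminus\mathcal I_{\mathcal E}$, and put $\mathcal N(\mathcal S,\mathcal I)=\overline{\mathcal E}\cup\mathcal N(\mathcal S,\mathcal I')$. For an automorphism $\alpha$ of $G$, $\mathcal S^\alpha$, $\mathcal I^\alpha$, etc. denote the images under the induced action of $\alpha$ on vertex sets, sets of vertex sets, separations $(A,B)^\alpha=(A^\alpha,B^\alpha)$, and sets of separations. *)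

theory Defs
  imports
    "Graph_Theory.Digraph_Component"
    "HOL-Algebra.Bij"
begin

text \<open>
  A finite graph is a \<^locale>\<open>pair_graph\<close>: a finite, symmetric, loopfree digraph without parallel
  arcs, an undirected edge being the pair of its two orientations.
\<close>

section \<open>Separations\<close>

type_synonym 'a separation = "'a set \<times> 'a set"

definition separation :: "'a pair_pre_digraph \<Rightarrow> 'a separation \<Rightarrow> bool" where
  "separation G = (\<lambda>(A, B). A \<subseteq> pverts G \<and> B \<subseteq> pverts G \<and>
     Digraph_Component.union (induce_subgraph (with_proj G) A) (induce_subgraph (with_proj G) B)
       = with_proj G)"

definition proper_sep :: "'a separation \<Rightarrow> bool" where
  "proper_sep = (\<lambda>(A, B). A - B \<noteq> {} \<and> B - A \<noteq> {})"

definition sep_le :: "'a separation \<Rightarrow> 'a separation \<Rightarrow> bool" where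
  "sep_le = (\<lambda>(A, B) (C, D). A \<subseteq> C \<and> D \<subseteq> B)"

definition nested :: "'a separation \<Rightarrow> 'a separation \<Rightarrow> bool" where
  "nested s t \<longleftrightarrow> sep_le s t \<or> sep_le t s \<or> sep_le s (prod.swap t) \<or> sep_le (prod.swap t) s"

abbreviation crossing :: "'a separation \<Rightarrow> 'a separation \<Rightarrow> bool" where
  "crossing s t \<equiv> \<not> nested s t"

definition separation_system :: "'a pair_pre_digraph \<Rightarrow> 'a separation set \<Rightarrow> bool" where
  "separation_system G S \<longleftrightarrow>
     (\<forall>s\<in>S. separation G s \<and> proper_sep s) \<and> (\<forall>A B. (A, B) \<in> S \<longrightarrow> (B, A) \<in> S)"

definition separates :: "'a separation \<Rightarrow> 'a set \<Rightarrow> bool" where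
  "separates = (\<lambda>(A, B) I. I \<inter> (A - B) \<noteq> {} \<and> I \<inter> (B - A) \<noteq> {})"

definition inseparable :: "'a separation set \<Rightarrow> 'a set \<Rightarrow> bool" where
  "inseparable S I \<longleftrightarrow> \<not> (\<exists>s\<in>S. separates s I)"

definition weakly_separates :: "'a separation \<Rightarrow> 'a set \<Rightarrow> 'a set \<Rightarrow> bool" where
  "weakly_separates = (\<lambda>(A, B) I J. (I \<subseteq> A \<and> J \<subseteq> B) \<or> (J \<subseteq> A \<and> I \<subseteq> B))"

definition weakly_distinguishable :: "'a separation set \<Rightarrow> 'a set \<Rightarrow> 'a set \<Rightarrow> bool" where
  "weakly_distinguishable S I J \<longleftrightarrow> (\<exists>s\<in>S. weakly_separates s I J)"

text \<open>
  The two sets must be distinct: every \<open>(A, B)\<close> weakly separates any \<open>I \<subseteq> A \<inter> B\<close> from itself.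
\<close>

definition relevant :: "'a set set \<Rightarrow> 'a separation \<Rightarrow> bool" where
  "relevant \<I> s \<longleftrightarrow> (\<exists>I\<in>\<I>. \<exists>J\<in>\<I>. I \<noteq> J \<and> weakly_separates s I J)"

definition separates_well :: "'a separation set \<Rightarrow> 'a set set \<Rightarrow> bool" where
  "separates_well S \<I> \<longleftrightarrow>
     (\<forall>A B C D. (A, B) \<in> S \<longrightarrow> (C, D) \<in> S \<longrightarrow> crossing (A, B) (C, D) \<longrightarrow>
       (\<forall>I\<^sub>1\<in>\<I>. \<forall>I\<^sub>2\<in>\<I>. I\<^sub>1 \<subseteq> A \<inter> C \<longrightarrow> I\<^sub>2 \<subseteq> B \<inter> D \<longrightarrow>
         (\<exists>(E, F)\<in>S. I\<^sub>1 \<subseteq> E \<and> E \<subseteq> A \<inter> C \<and> B \<union> D \<subseteq> F)))"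

definition extremal :: "'a separation set \<Rightarrow> 'a separation set" where
  "extremal R = {s \<in> R. \<forall>t\<in>R. sep_le s t \<or> sep_le s (prod.swap t)}"

section \<open>The nested subsystem\<close>

text \<open>
  The recursion terminates as long as \<open>\<I>\<close> shrinks, which needs hypotheses on \<open>S\<close> and \<open>\<I>\<close>; the
  function is therefore partial, and \<open>nested_subsystem_dom\<close> below shows that the hypotheses of the
  construction put \<open>(S, \<I>)\<close> into its domain.
\<close>

definition extremal_relevant :: "'a separation set \<Rightarrow> 'a set set \<Rightarrow> 'a separation set" where
  "extremal_relevant S \<I> = extremal {s \<in> S. relevant \<I> s}"

definition extremal_sets :: "'a separation set \<Rightarrow> 'a set set \<Rightarrow> 'a set set" where
  "extremal_sets S \<I> = {I \<in> \<I>. \<exists>(E, F)\<in>extremal_relevant S \<I>. I \<subseteq> E}"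

function (domintros) nested_subsystem :: "'a separation set \<Rightarrow> 'a set set \<Rightarrow> 'a separation set"
  where
  "nested_subsystem S \<I> =
     (if \<not> (\<exists>I\<in>\<I>. \<exists>J\<in>\<I>. I \<noteq> J \<and> weakly_distinguishable S I J) then {}
      else {(A, B). (A, B) \<in> extremal_relevant S \<I> \<or> (B, A) \<in> extremal_relevant S \<I>}
           \<union> nested_subsystem S (\<I> - extremal_sets S \<I>))"
  by pat_completeness auto

lemma ex_extremal_relevant:
  assumes fin: "finite S"
    and cover: "\<And>A B. (A, B) \<in> S \<Longrightarrow> A \<union> B = V"
    and sym: "\<And>A B. (A, B) \<in> S \<Longrightarrow> (B, A) \<in> S"
    and insep: "\<And>I. I \<in> \<I> \<Longrightarrow> I \<subseteq> V \<and> inseparable S I"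
    and well: "separates_well S \<I>"
    and ne: "s0 \<in> S" "relevant \<I> s0"
  shows "\<exists>s. s \<in> extremal_relevant S \<I>"
proof -
  define R where "R = {s \<in> S. relevant \<I> s}"
  define r where "r = {(s, t). sep_le s t \<and> s \<noteq> t} \<inter> R \<times> R"
  have finR: "finite R" and R0: "s0 \<in> R" using fin ne by (auto simp: R_def)
  have le_trans: "sep_le s u" if "sep_le s t" "sep_le t u" for s t u :: "'a separation"
    using that by (fastforce simp: sep_le_def split: prod.splits)
  have le_antisym: "s = t" if "sep_le s t" "sep_le t s" for s t :: "'a separation"
    using that by (fastforce simp: sep_le_def split: prod.splits)
  have "trans r" unfolding r_def trans_def using le_trans le_antisym by blast
  moreover have "irrefl r" by (auto simp: r_def irrefl_def)
  moreover have "finite r" using finR by (auto simp: r_def)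
  ultimately have "wf r"
    by (simp add: finite_acyclic_wf acyclic_irrefl)
  then obtain m where m: "m \<in> R" and min: "\<And>t. (t, m) \<in> r \<Longrightarrow> t \<notin> R"
    using R0 wfE_min by metis
  obtain A B where AB: "m = (A, B)" by fastforce
  have min': "t = m" if "t \<in> R" "sep_le t m" for t
    using min[of t] that m by (auto simp: r_def)
  have relsym: "relevant \<I> (D, C)" if "relevant \<I> (C, D)" for C D :: "'a set"
    using that by (auto simp: relevant_def weakly_separates_def)
  have Rsym: "(D, C) \<in> R" if "(C, D) \<in> R" for C D
    using that sym relsym by (auto simp: R_def)
  have side: "I \<subseteq> C \<or> I \<subseteq> D" if "(C, D) \<in> S" "I \<in> \<I>" for C D I
    using cover[OF that(1)] insep[OF that(2)] that(1)
    unfolding inseparable_def separates_def by fastforce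
  have corner: "sep_le m (C, D)"
    if c: "(C, D) \<in> S" "crossing m (C, D)" "I1 \<in> \<I>" "I2 \<in> \<I>" "I1 \<noteq> I2"
      "I1 \<subseteq> A \<inter> C" "I2 \<subseteq> B \<inter> D" for C D I1 I2
  proof -
    have "(A, B) \<in> S" using m AB by (simp add: R_def)
    then obtain E F where EF: "(E, F) \<in> S" "I1 \<subseteq> E" "E \<subseteq> A \<inter> C" "B \<union> D \<subseteq> F"
      using well[unfolded separates_well_def, rule_format, of A B C D I1 I2] c AB by auto
    have "weakly_separates (E, F) I1 I2" using EF c by (auto simp: weakly_separates_def)
    then have "(E, F) \<in> R" using EF(1) c(3-5) unfolding R_def relevant_def by blast
    moreover have "sep_le (E, F) m" using EF by (simp add: AB sep_le_def)
    ultimately have "(E, F) = m" by (rule min')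
    then show ?thesis using EF by (simp add: AB sep_le_def)
  qed
  have relevantE: "\<exists>I\<in>\<I>. \<exists>J\<in>\<I>. I \<noteq> J \<and> I \<subseteq> C \<and> J \<subseteq> D" if "(C, D) \<in> R" for C D
    using that by (auto simp: R_def relevant_def weakly_separates_def)
  have crossing_swap: "crossing m (D, C)" if "crossing m (C, D)" for C D
    using that by (auto simp: nested_def)
  have cross: False if CD: "(C, D) \<in> R" and cr: "crossing m (C, D)" and I1: "I1 \<in> \<I>"
    "I1 \<subseteq> A" "I1 \<subseteq> C" and I2: "I2 \<in> \<I>" "I2 \<subseteq> B" "I1 \<noteq> I2" for C D I1 I2
  proof -
    have S: "(C, D) \<in> S" "(D, C) \<in> S" "(A, B) \<in> S" using CD Rsym[OF CD] m AB by (auto simp: R_def)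
    have crs: "crossing m (D, C)" using crossing_swap[OF cr] .
    have no: "\<not> sep_le m (C, D)" "\<not> sep_le m (D, C)" using cr by (auto simp: nested_def)
    have n1: False if "J \<in> \<I>" "K \<in> \<I>" "J \<noteq> K" "J \<subseteq> A" "J \<subseteq> C" "K \<subseteq> B" "K \<subseteq> D" for J K
      using corner[OF S(1) cr that(1-3)] that no by blast
    have n2: False if "J \<in> \<I>" "K \<in> \<I>" "J \<noteq> K" "J \<subseteq> A" "J \<subseteq> D" "K \<subseteq> B" "K \<subseteq> C" for J K
      using corner[OF S(2) crs that(1-3)] that no by blast
    have I2D: "\<not> I2 \<subseteq> D" using n1[OF I1(1) I2(1,3) I1(2,3) I2(2)] by blast
    then have I2C: "I2 \<subseteq> C" using side[OF S(1) I2(1)] by blast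
    obtain K where K: "K \<in> \<I>" "K \<subseteq> D" using relevantE[OF CD] by blast
    have "K \<noteq> I2" using K I2D by blast
    consider "K \<subseteq> A" | "K \<subseteq> B" using side[OF S(3) K(1)] by blast
    then show False
    proof cases
      case 1 then show False using n2[OF K(1) I2(1) \<open>K \<noteq> I2\<close> _ K(2) I2(2) I2C] by blast
    next
      case 2
      show False
      proof (cases "K = I1")
        case True then show False using n2[OF I1(1) I2(1,3) I1(2) _ I2(2) I2C] K(2) by blast
      next
        case False then show False using n1[OF I1(1) K(1) _ I1(2,3) 2 K(2)] by blast
      qed
    qed
  qed
  obtain I1 I2 where I: "I1 \<in> \<I>" "I2 \<in> \<I>" "I1 \<noteq> I2" "I1 \<subseteq> A" "I2 \<subseteq> B"
    using relevantE m AB by blast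
  have "sep_le m t \<or> sep_le m (prod.swap t)" if t: "t \<in> R" for t
  proof (cases "nested m t")
    case True
    obtain C D where CD: "t = (C, D)" by fastforce
    then have sw: "prod.swap t \<in> R" using t Rsym by simp
    have refl: "sep_le m m" by (simp add: AB sep_le_def)
    show ?thesis using True min'[OF t] min'[OF sw] refl unfolding nested_def by auto
  next
    case False
    obtain C D where CD: "t = (C, D)" by fastforce
    have "(C, D) \<in> S" using t CD by (simp add: R_def)
    then consider "I1 \<subseteq> C" | "I1 \<subseteq> D" using side I by blast
    then show ?thesis
    proof cases
      case 1 then show ?thesis using cross[of C D I1 I2] t False I unfolding CD by blast
    next
      case 2
      have "(D, C) \<in> R" "crossing m (D, C)"
        using t CD False Rsym crossing_swap by auto
      then show ?thesis using cross[of D C I1 I2] 2 I by blast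
    qed
  qed
  then have "m \<in> extremal R" using m by (auto simp: extremal_def)
  then show ?thesis unfolding extremal_relevant_def R_def by blast
qed

lemma nested_subsystem_dom:
  assumes "pair_graph G" and "separation_system G S"
    and "\<forall>I\<in>\<I>. I \<subseteq> pverts G \<and> inseparable S I"
    and "separates_well S \<I>"
  shows "nested_subsystem_dom (S, \<I>)"
proof -
  have finV: "finite (pverts G)"
    using assms(1) unfolding pair_graph_def pair_digraph_def
    by (blast intro: pair_fin_digraph.pair_finite_verts)
  have seps: "S \<subseteq> Pow (pverts G) \<times> Pow (pverts G)"
    using assms(2) by (fastforce simp: separation_system_def separation_def)
  have finS: "finite S" by (rule finite_subset[OF seps]) (simp add: finV)
  have cover: "A \<union> B = pverts G" if "(A, B) \<in> S" for A B
  proof -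
    have "separation G (A, B)"
      using that assms(2) unfolding separation_system_def by blast
    then have "Digraph_Component.union (induce_subgraph (with_proj G) A)
        (induce_subgraph (with_proj G) B) = with_proj G"
      by (simp only: separation_def prod.case)
    then have "verts (Digraph_Component.union (induce_subgraph (with_proj G) A)
        (induce_subgraph (with_proj G) B)) = verts (with_proj G)"
      by (rule arg_cong)
    then show ?thesis by simp
  qed
  have sym: "(B, A) \<in> S" if "(A, B) \<in> S" for A B
    using that assms(2) by (auto simp: separation_system_def)
  have "\<I> \<subseteq> Pow (pverts G)" using assms(3) by auto
  then have "finite \<I>" using finV finite_subset by blast
  then show ?thesis using assms(3,4)
  proof (induction \<I> rule: finite_psubset_induct)
    case (psubset \<I>)
    show ?case
    proof -
      have dom: "nested_subsystem_dom (S, \<I> - extremal_sets S \<I>)"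
        if IJ: "I \<in> \<I>" "J \<in> \<I>" "I \<noteq> J" "weakly_distinguishable S I J" for I J
      proof -
        from IJ obtain s0 where "s0 \<in> S" "relevant \<I> s0"
          unfolding weakly_distinguishable_def relevant_def by blast
        then obtain s where s: "s \<in> extremal_relevant S \<I>"
          using ex_extremal_relevant[OF finS cover sym _ psubset.prems(2)] psubset.prems(1) by blast
        obtain E F where EF: "s = (E, F)" by fastforce
        have "relevant \<I> (E, F)" using s EF by (auto simp: extremal_relevant_def extremal_def)
        then obtain K where "K \<in> \<I>" "K \<subseteq> E"
          by (auto simp: relevant_def weakly_separates_def)
        then have "K \<in> extremal_sets S \<I>"
          using s unfolding EF extremal_sets_def by auto
        then have "extremal_sets S \<I> \<noteq> {}" by blast
        moreover have "extremal_sets S \<I> \<subseteq> \<I>" by (auto simp: extremal_sets_def)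
        ultimately have sub: "\<I> - extremal_sets S \<I> \<subset> \<I>" by blast
        have well: "separates_well S (\<I> - extremal_sets S \<I>)"
          unfolding separates_well_def
        proof (intro allI ballI impI)
          fix A B C D I1 I2
          assume "(A, B) \<in> S" "(C, D) \<in> S" "crossing (A, B) (C, D)"
            "I1 \<in> \<I> - extremal_sets S \<I>" "I2 \<in> \<I> - extremal_sets S \<I>"
            "I1 \<subseteq> A \<inter> C" "I2 \<subseteq> B \<inter> D"
          then show "\<exists>(E, F)\<in>S. I1 \<subseteq> E \<and> E \<subseteq> A \<inter> C \<and> B \<union> D \<subseteq> F"
            using psubset.prems(2)[unfolded separates_well_def, rule_format, of A B C D I1 I2]
            by simp
        qed
        show ?thesis
          using psubset.IH[OF sub] well psubset.prems(1) by simp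
      qed
      show ?thesis
        by (rule nested_subsystem.domintros) (metis dom)+
    qed
  qed
qed

section \<open>Automorphisms and their action\<close>

text \<open>
  As in \<^theory>\<open>HOL-Algebra.Bij\<close>, bijections of the vertex set are extensional functions.
\<close>

definition graph_auts :: "'a pair_pre_digraph \<Rightarrow> ('a \<Rightarrow> 'a) set" where
  "graph_auts G = {\<alpha> \<in> Bij (pverts G).
     \<forall>u\<in>pverts G. \<forall>v\<in>pverts G. (\<alpha> u, \<alpha> v) \<in> parcs G \<longleftrightarrow> (u, v) \<in> parcs G}"

definition graph_aut_group :: "'a pair_pre_digraph \<Rightarrow> ('a \<Rightarrow> 'a) monoid" where
  "graph_aut_group G = BijGroup (pverts G) \<lparr>carrier := graph_auts G\<rparr>"

definition act_sets :: "('a \<Rightarrow> 'a) \<Rightarrow> 'a set set \<Rightarrow> 'a set set" where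
  "act_sets \<alpha> \<I> = (\<lambda>I. \<alpha> ` I) ` \<I>"

definition act_seps :: "('a \<Rightarrow> 'a) \<Rightarrow> 'a separation set \<Rightarrow> 'a separation set" where
  "act_seps \<alpha> S = (\<lambda>(A, B). (\<alpha> ` A, \<alpha> ` B)) ` S"

end

theory Submission
  imports Defs
begin

text \<open>
  The construction of the nested subsystem speaks of vertex sets only through inclusion and
  equality. A map \<open>f\<close> that is injective on \<open>V\<close> preserves and reflects both for subsets
  of \<open>V\<close>, so each notion entering one step of the recursion (relevance, extremality, the sets
  discarded after the step) commutes with \<open>f\<close>: see \<open>extremal_relevant_act\<close> and
  \<open>extremal_sets_act\<close>. Induction along the recursion then gives \<open>nested_subsystem_act\<close>.
  Termination of the recursion on \<open>(S, \<I>)\<close> is \<open>nested_subsystem_dom\<close>; the recursion on the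
  image unfolds in parallel, so its termination comes out of the same induction.

  An automorphism of the graph is in particular injective on the vertices, which gives the first
  assertion. An automorphism fixing \<open>S\<close> and \<open>\<I>\<close> then fixes the nested subsystem, because the
  construction involves no choices; this is the assertion on groups.
\<close>

lemma bex_act_seps: "(\<exists>s\<in>act_seps f S. P s) \<longleftrightarrow> (\<exists>(A, B)\<in>S. P (f ` A, f ` B))"
  unfolding act_seps_def bex_simps by (rule bex_cong) (auto split: prod.splits)

lemma ball_act_seps: "(\<forall>s\<in>act_seps f S. P s) \<longleftrightarrow> (\<forall>(A, B)\<in>S. P (f ` A, f ` B))"
  unfolding act_seps_def ball_simps by (rule ball_cong) (auto split: prod.splits)

lemma mem_act_seps: "s \<in> act_seps f S \<longleftrightarrow> (\<exists>A B. (A, B) \<in> S \<and> s = (f ` A, f ` B))"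
  unfolding act_seps_def image_iff by (auto simp: Bex_def)

lemma act_seps_filter:
  assumes "\<And>A B. (A, B) \<in> S \<Longrightarrow> P (f ` A, f ` B) \<longleftrightarrow> Q (A, B)"
  shows "{s \<in> act_seps f S. P s} = act_seps f {s \<in> S. Q s}"
  using assms by (simp only: set_eq_iff mem_act_seps mem_Collect_eq) blast

lemma act_sets_filter:
  assumes "\<And>I. I \<in> \<I> \<Longrightarrow> P (f ` I) \<longleftrightarrow> Q I"
  shows "{I \<in> act_sets f \<I>. P I} = act_sets f {I \<in> \<I>. Q I}"
  using assms unfolding act_sets_def by blast

context
  fixes f :: "'a \<Rightarrow> 'a" and V :: "'a set"
  assumes inj: "inj_on f V"
begin

lemma image_subset_iff_on:
  "A \<subseteq> V \<Longrightarrow> B \<subseteq> V \<Longrightarrow> f ` A \<subseteq> f ` B \<longleftrightarrow> A \<subseteq> B"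
  using inj unfolding inj_on_def by blast

lemma image_eq_iff_on:
  "A \<subseteq> V \<Longrightarrow> B \<subseteq> V \<Longrightarrow> f ` A = f ` B \<longleftrightarrow> A = B"
  using inj_on_image_eq_iff[OF inj] by blast

lemma weakly_separates_image:
  assumes "A \<subseteq> V" "B \<subseteq> V" "I \<subseteq> V" "J \<subseteq> V"
  shows "weakly_separates (f ` A, f ` B) (f ` I) (f ` J) \<longleftrightarrow> weakly_separates (A, B) I J"
  using assms by (simp add: weakly_separates_def image_subset_iff_on)

lemma sep_le_image:
  assumes "A \<subseteq> V" "B \<subseteq> V" "C \<subseteq> V" "D \<subseteq> V"
  shows "sep_le (f ` A, f ` B) (f ` C, f ` D) \<longleftrightarrow> sep_le (A, B) (C, D)"
  using assms by (simp add: sep_le_def image_subset_iff_on)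

lemma weakly_distinguishable_act:
  assumes "S \<subseteq> Pow V \<times> Pow V" "I \<subseteq> V" "J \<subseteq> V"
  shows "weakly_distinguishable (act_seps f S) (f ` I) (f ` J) \<longleftrightarrow> weakly_distinguishable S I J"
proof -
  have "weakly_separates (f ` A, f ` B) (f ` I) (f ` J) \<longleftrightarrow> weakly_separates (A, B) I J"
    if "(A, B) \<in> S" for A B
    using that assms by (intro weakly_separates_image) auto
  then show ?thesis
    unfolding weakly_distinguishable_def bex_act_seps
    by (intro bex_cong refl) (simp only: split_paired_all prod.case)
qed

text \<open>
  Relevance asks for two distinct sets, so their images must stay distinct.
\<close>

lemma relevant_act:
  assumes "\<I> \<subseteq> Pow V" "A \<subseteq> V" "B \<subseteq> V"
  shows "relevant (act_sets f \<I>) (f ` A, f ` B) \<longleftrightarrow> relevant \<I> (A, B)"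
proof -
  have "f ` I \<noteq> f ` J \<and> weakly_separates (f ` A, f ` B) (f ` I) (f ` J) \<longleftrightarrow>
      I \<noteq> J \<and> weakly_separates (A, B) I J" if "I \<in> \<I>" "J \<in> \<I>" for I J
    using that assms weakly_separates_image[of A B I J] image_eq_iff_on[of I J] by blast
  then show ?thesis
    by (simp add: relevant_def act_sets_def)
qed

lemma extremal_act:
  assumes R: "R \<subseteq> Pow V \<times> Pow V"
  shows "extremal (act_seps f R) = act_seps f (extremal R)"
proof -
  have le: "sep_le (f ` A, f ` B) (f ` C, f ` D) \<longleftrightarrow> sep_le (A, B) (C, D)"
           "sep_le (f ` A, f ` B) (f ` D, f ` C) \<longleftrightarrow> sep_le (A, B) (D, C)"
    if "(A, B) \<in> R" "(C, D) \<in> R" for A B C D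
    using that R sep_le_image[of A B C D] sep_le_image[of A B D C] by blast+
  show ?thesis
    unfolding extremal_def
  proof (rule act_seps_filter)
    fix A B assume "(A, B) \<in> R"
    from le[OF this] show
      "(\<forall>t\<in>act_seps f R. sep_le (f ` A, f ` B) t \<or> sep_le (f ` A, f ` B) (prod.swap t)) \<longleftrightarrow>
        (\<forall>t\<in>R. sep_le (A, B) t \<or> sep_le (A, B) (prod.swap t))"
      unfolding ball_act_seps swap_simp by fastforce
  qed
qed

lemma extremal_relevant_act:
  assumes "S \<subseteq> Pow V \<times> Pow V" "\<I> \<subseteq> Pow V"
  shows "extremal_relevant (act_seps f S) (act_sets f \<I>) = act_seps f (extremal_relevant S \<I>)"
proof -
  have "relevant (act_sets f \<I>) (f ` A, f ` B) \<longleftrightarrow> relevant \<I> (A, B)" if "(A, B) \<in> S" for A B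
    using that assms by (intro relevant_act) auto
  then have "{s \<in> act_seps f S. relevant (act_sets f \<I>) s} = act_seps f {s \<in> S. relevant \<I> s}"
    by (rule act_seps_filter)
  moreover have "{s \<in> S. relevant \<I> s} \<subseteq> Pow V \<times> Pow V"
    using assms by blast
  ultimately show ?thesis
    by (simp add: extremal_relevant_def extremal_act)
qed

lemma extremal_sets_act:
  assumes S: "S \<subseteq> Pow V \<times> Pow V" and \<I>: "\<I> \<subseteq> Pow V"
  shows "extremal_sets (act_seps f S) (act_sets f \<I>) = act_sets f (extremal_sets S \<I>)"
proof -
  have "extremal_relevant S \<I> \<subseteq> Pow V \<times> Pow V"
    using S by (auto simp: extremal_relevant_def extremal_def)
  then have "f ` I \<subseteq> f ` E \<longleftrightarrow> I \<subseteq> E" if "I \<in> \<I>" "(E, F) \<in> extremal_relevant S \<I>" for I E F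
    using that \<I> by (intro image_subset_iff_on) auto
  then have "(\<exists>(E, F)\<in>act_seps f (extremal_relevant S \<I>). f ` I \<subseteq> E) \<longleftrightarrow>
      (\<exists>(E, F)\<in>extremal_relevant S \<I>. I \<subseteq> E)" if "I \<in> \<I>" for I
    unfolding bex_act_seps using that by (intro bex_cong refl) (simp only: split_paired_all prod.case)
  then show ?thesis
    unfolding extremal_sets_def extremal_relevant_act[OF S \<I>] by (rule act_sets_filter)
qed

lemma act_sets_Diff:
  assumes "\<I> \<subseteq> Pow V" "\<J> \<subseteq> Pow V"
  shows "act_sets f (\<I> - \<J>) = act_sets f \<I> - act_sets f \<J>"
  unfolding act_sets_def
  by (rule inj_on_image_set_diff[OF inj_on_image_Pow[OF inj]]) (use assms in auto)

lemma symmetrize_act_seps: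
  "{(A, B). (A, B) \<in> act_seps f X \<or> (B, A) \<in> act_seps f X} =
     act_seps f {(A, B). (A, B) \<in> X \<or> (B, A) \<in> X}"
  by (simp only: set_eq_iff split_paired_All mem_act_seps mem_Collect_eq prod.case prod.inject) blast

text \<open>
  Since the value of a partial function is known only on its domain, termination on the image is
  part of the induction: the recursion equation for the image can be used only after it.
\<close>

lemma nested_subsystem_act:
  assumes "nested_subsystem_dom (S, \<I>)" "S \<subseteq> Pow V \<times> Pow V" "\<I> \<subseteq> Pow V"
  shows "nested_subsystem_dom (act_seps f S, act_sets f \<I>) \<and>
    nested_subsystem (act_seps f S) (act_sets f \<I>) = act_seps f (nested_subsystem S \<I>)"
  using assms
proof (induction S \<I> rule: nested_subsystem.pinduct)
  case (1 S \<I>)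
  let ?c = "\<lambda>S \<I>. \<exists>I\<in>\<I>. \<exists>J\<in>\<I>. I \<noteq> J \<and> weakly_distinguishable S I J"
  let ?S = "act_seps f S" and ?I = "act_sets f \<I>"
  have "f ` I \<noteq> f ` J \<and> weakly_distinguishable ?S (f ` I) (f ` J) \<longleftrightarrow>
      I \<noteq> J \<and> weakly_distinguishable S I J" if "I \<in> \<I>" "J \<in> \<I>" for I J
    using that 1(3,4) weakly_distinguishable_act[of S I J] image_eq_iff_on[of I J] by blast
  then have c: "?c ?S ?I \<longleftrightarrow> ?c S \<I>"
    by (simp add: act_sets_def)
  have sub: "extremal_sets S \<I> \<subseteq> \<I>"
    by (auto simp: extremal_sets_def)
  \<comment> \<open>Injectivity is essential here: otherwise a discarded set and a remaining one could have
    the same image.\<close>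
  have rest: "?I - extremal_sets ?S ?I = act_sets f (\<I> - extremal_sets S \<I>)"
    using sub 1(4) by (simp add: extremal_sets_act[OF 1(3,4)] act_sets_Diff subset_trans)
  have IH: "nested_subsystem_dom (?S, ?I - extremal_sets ?S ?I)"
    "nested_subsystem ?S (?I - extremal_sets ?S ?I) =
      act_seps f (nested_subsystem S (\<I> - extremal_sets S \<I>))" if "?c S \<I>"
    using that 1(2) 1(3,4) unfolding rest by blast+
  have "nested_subsystem_dom (?S, ?I - extremal_sets ?S ?I)"
    if "I \<in> ?I" "J \<in> ?I" "I \<noteq> J" "weakly_distinguishable ?S I J" for I J
    using that IH(1) c by blast
  then have dom: "nested_subsystem_dom (?S, ?I)"
    by - (rule nested_subsystem.domintros, metis+)
  moreover have "nested_subsystem ?S ?I = act_seps f (nested_subsystem S \<I>)"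
  proof (cases "?c S \<I>")
    case True
    have "nested_subsystem ?S ?I =
        {(A, B). (A, B) \<in> extremal_relevant ?S ?I \<or> (B, A) \<in> extremal_relevant ?S ?I}
        \<union> nested_subsystem ?S (?I - extremal_sets ?S ?I)"
      by (rule trans[OF nested_subsystem.psimps[OF dom] if_not_P]) (use True c in blast)
    also have "\<dots> =
        act_seps f {(A, B). (A, B) \<in> extremal_relevant S \<I> \<or> (B, A) \<in> extremal_relevant S \<I>}
        \<union> act_seps f (nested_subsystem S (\<I> - extremal_sets S \<I>))"
      by (simp only: IH(2)[OF True] extremal_relevant_act[OF 1(3,4)] symmetrize_act_seps)
    also have "\<dots> = act_seps f
        ({(A, B). (A, B) \<in> extremal_relevant S \<I> \<or> (B, A) \<in> extremal_relevant S \<I>}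
        \<union> nested_subsystem S (\<I> - extremal_sets S \<I>))"
      by (simp only: act_seps_def image_Un)
    also have "\<dots> = act_seps f (nested_subsystem S \<I>)"
      by (rule arg_cong[OF sym], rule trans[OF nested_subsystem.psimps[OF 1(1)] if_not_P])
        (use True in blast)
    finally show ?thesis .
  next
    case False
    have "nested_subsystem ?S ?I = {}"
      by (rule trans[OF nested_subsystem.psimps[OF dom] if_P]) (use False c in blast)
    moreover have "nested_subsystem S \<I> = {}"
      by (rule trans[OF nested_subsystem.psimps[OF 1(1)] if_P]) (use False in blast)
    ultimately show ?thesis
      by (simp add: act_seps_def)
  qed
  ultimately show ?case ..
qed

end

theorem corollary5p3:
  fixes G :: "'a pair_pre_digraph"
    and S :: "'a separation set"
    and \<I> :: "'a set set"
  assumes "pair_graph G"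
    and "separation_system G S"
    and "\<forall>I\<in>\<I>. I \<subseteq> pverts G \<and> inseparable S I"
    and "separates_well S \<I>"
  shows "(\<forall>\<alpha>\<in>graph_auts G.
            nested_subsystem (act_seps \<alpha> S) (act_sets \<alpha> \<I>) = act_seps \<alpha> (nested_subsystem S \<I>)) \<and>
         (\<forall>\<Gamma>. subgroup \<Gamma> (graph_aut_group G) \<longrightarrow>
            (\<forall>\<alpha>\<in>\<Gamma>. act_seps \<alpha> S = S \<and> act_sets \<alpha> \<I> = \<I>) \<longrightarrow>
            (\<forall>\<alpha>\<in>\<Gamma>. act_seps \<alpha> (nested_subsystem S \<I>) = nested_subsystem S \<I>))"
proof -
  have dom: "nested_subsystem_dom (S, \<I>)"
    using assms by (rule nested_subsystem_dom)
  have S: "S \<subseteq> Pow (pverts G) \<times> Pow (pverts G)"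
    using assms(2) by (fastforce simp: separation_system_def separation_def)
  have \<I>: "\<I> \<subseteq> Pow (pverts G)"
    using assms(3) by blast
  have equi: "nested_subsystem (act_seps \<alpha> S) (act_sets \<alpha> \<I>) = act_seps \<alpha> (nested_subsystem S \<I>)"
    if "\<alpha> \<in> graph_auts G" for \<alpha>
  proof -
    have "inj_on \<alpha> (pverts G)"
      using that by (auto simp: graph_auts_def Bij_def bij_betw_def)
    then show ?thesis
      using nested_subsystem_act dom S \<I> by blast
  qed
  have sub: "\<Gamma> \<subseteq> graph_auts G" if "subgroup \<Gamma> (graph_aut_group G)" for \<Gamma>
    using subgroup.subset[OF that] by (simp add: graph_aut_group_def)
  have "act_seps \<alpha> (nested_subsystem S \<I>) = nested_subsystem S \<I>"
    if "subgroup \<Gamma> (graph_aut_group G)" "\<forall>\<alpha>\<in>\<Gamma>. act_seps \<alpha> S = S \<and> act_sets \<alpha> \<I> = \<I>" "\<alpha> \<in> \<Gamma>"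
    for \<Gamma> \<alpha>
    using equi[of \<alpha>] sub[OF that(1)] that(2,3) by auto
  with equi show ?thesis
    by blast
qed

end
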